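(* In LP$^{\mathrm{MLN}}$ (i.e. with respect to semi-strong equivalence $\equiv_{s,s}$), the S-RP transformation is both SE-preserving and NSE-preserving.
   Context: Atoms are propositional. A rule $r$ is an expression $h_1\vee\cdots\vee h_k\leftarrow b_1,\dots,b_m,\mathit{not}\,c_1,\dots,\mathit{not}\,c_n$ ($k,m,n\ge 0$) with atoms $h_i,b_i,c_i$; write $H(r)=\{h_1,\dots,h_k\}$, $B^+(r)=\{b_1,\dots,b_m\}$, $B^-(r)=\{c_1,\dots,c_n\}$. A program is a finite set of rules. An interpretation is a set $X$ of atoms; $X\models r$ iff $X\cap H(r)\neq\emptyset$ or $B^+(r)\not\subseteq X$ or $B^-(r)\cap X\neq\emptyset$; $X\models P$ iff $X$ satisfies every rule of $P$. The GL-reduct is $P^X=\{H(r)\leftarrow B^+(r) : r\in P,\ B^-(r)\cap X=\emptyset\}$; $X$ is an ASP stable model of $P$ iff $X\models P^X$ and no proper subset of $X$ satisfies $P^X$. LP$^{\mathrm{MLN}}$ rules carry weights, but weights are irrelevant here and omitted, so an LP$^{\mathrm{MLN}}$ program is just a program; $X$ is an LP$^{\mathrm{MLN}}$ stable model of $P$ iff $X$ is an ASP stable model of $P_X=\{r\in P: X\models r\}$. Programs $P,Q$ are semi-strongly equivalent, $P\equiv_{s,s}Q$, iff for every program $R$, $P\cup R$ and $Q\cup R$ have the same LP$^{\mathrm{MLN}}$ stable models. Tuples and independent sets: programs are regarded as tuples of rules (repetitions allowed); for $P=\langle r_1,\dots,r_p\rangle$, $Q=\langle t_1,\dots,t_q\rangle$,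 $\langle P,Q\rangle=\langle r_1,\dots,r_p,t_1,\dots,t_q\rangle$. For a tuple $T=\langle r_1,\dots,r_n\rangle$ let $at(T)$ be its set of atoms and $\langle S_1,\dots,S_{3n}\rangle=\langle H(r_1),B^+(r_1),B^-(r_1),\dots,H(r_n),B^+(r_n),B^-(r_n)\rangle$. For each nonempty $N'\subseteq\{1,\dots,3n\}$ the independent set is $I_{N'}=\bigcap_{i\in N'}S_i\setminus\bigcup_{j\in\{1,\dots,3n\}\setminus N'}S_j$; it is named $I_k$ with $k=\sum_{i\in N'}2^{3n-i}$, $1\le k<2^{3n}$. Independent sets are pairwise disjoint and cover $at(T)$. S-* transformations: let $I_k=I_{N'}$ be an independent set of $T$ and $a'\notin at(T)$ a fresh atom. Replacing $a\in I_k$ by $a'$ means renaming every occurrence of $a$ in $T$ to $a'$; deleting $a\in I_k$ means removing $a$ from every rule of $T$; adding $a'$ to $I_k$ means adding $a'$ to each $S_i$ with $i\in N'$. S-RP: replace some $a\in I_k$ by $a'$ (requires $|I_k|>0$); S-DL: delete some $a\in I_k$, requires $|I_k|>2$; S-RD-$i$ ($i\in\{1,2\}$): delete some $a\in I_k$, requires $|I_k|=i$; S-AD: add $a'$ to $I_k$, requires $|I_k|\ge 2$; S-EX-$i$ ($i\in\{0,1\}$): add $a'$ to $I_k$, requires $|I_k|=i$. For a pair $T=\langle P,Q\rangle$ the result is $T^\circ=\langle P^\circ,Q^\circ\rangle$ where $P^\circ$ consists of the first $|P|$ rules. For a given equivalence $\equiv$, a transformation type is SE-preserving if for every pair $\langle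 P,Q\rangle$ and every admissible application, $P\equiv Q$ implies $P^\circ\equiv Q^\circ$; it is NSE-preserving if $P\not\equiv Q$ implies $P^\circ\not\equiv Q^\circ$. *)

theory Defs
  imports Main "HOL-Library.FSet"
begin

datatype 'a rule =
  Rule (head: "'a fset") (pos_body: "'a fset") (neg_body: "'a fset")

definition satisfies_rule :: "'a set \<Rightarrow> 'a rule \<Rightarrow> bool" where
  "satisfies_rule X r \<longleftrightarrow>
     X \<inter> fset (head r) \<noteq> {} \<or> \<not> fset (pos_body r) \<subseteq> X \<or> fset (neg_body r) \<inter> X \<noteq> {}"

definition satisfies :: "'a set \<Rightarrow> 'a rule set \<Rightarrow> bool" where
  "satisfies X P \<longleftrightarrow> (\<forall>r\<in>P. satisfies_rule X r)"

definition GL_reduct :: "'a rule set \<Rightarrow> 'a set \<Rightarrow> 'a rule set" where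
  "GL_reduct P X =
     {Rule (head r) (pos_body r) {||} | r. r \<in> P \<and> fset (neg_body r) \<inter> X = {}}"

definition ASP_stable_model :: "'a rule set \<Rightarrow> 'a set \<Rightarrow> bool" where
  "ASP_stable_model P X \<longleftrightarrow>
     satisfies X (GL_reduct P X) \<and> \<not> (\<exists>Y. Y \<subset> X \<and> satisfies Y (GL_reduct P X))"

definition LPMLN_stable_model :: "'a rule set \<Rightarrow> 'a set \<Rightarrow> bool" where
  "LPMLN_stable_model P X \<longleftrightarrow> ASP_stable_model {r \<in> P. satisfies_rule X r} X"

definition semi_strongly_equivalent :: "'a rule set \<Rightarrow> 'a rule set \<Rightarrow> bool" where
  "semi_strongly_equivalent P Q \<longleftrightarrow>
     (\<forall>R. finite R \<longrightarrow>
        {X. LPMLN_stable_model (P \<union> R) X} = {X. LPMLN_stable_model (Q \<union> R) X})"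

text \<open>Tuples of rules are lists; the program denoted by a tuple \<open>T\<close> is \<open>set T\<close>.\<close>

definition atoms :: "'a rule list \<Rightarrow> 'a set" where
  "atoms T = (\<Union>r\<in>set T. fset (head r) \<union> fset (pos_body r) \<union> fset (neg_body r))"

text \<open>\<open>component T i\<close> is the set \<open>S\<^sub>i\<close>; indices run from \<open>1\<close> to \<open>3 * length T\<close>.\<close>

definition component :: "'a rule list \<Rightarrow> nat \<Rightarrow> 'a set" where
  "component T i =
     concat (map (\<lambda>r. [fset (head r), fset (pos_body r), fset (neg_body r)]) T) ! (i - 1)"

definition independent_set :: "'a rule list \<Rightarrow> nat set \<Rightarrow> 'a set" where
  "independent_set T N =
     (\<Inter>i\<in>N. component T i) - (\<Union>j\<in>{1..3 * length T} - N. component T j)"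

definition replace_atom :: "'a \<Rightarrow> 'a \<Rightarrow> 'a rule list \<Rightarrow> 'a rule list" where
  "replace_atom a a' T = map (map_rule (\<lambda>x. if x = a then a' else x)) T"

text \<open>
  A transformation type is the relation between a tuple and its possible results.
\<close>

definition S_RP :: "'a rule list \<Rightarrow> 'a rule list \<Rightarrow> bool" where
  "S_RP T T' \<longleftrightarrow>
     (\<exists>N a a'. N \<noteq> {} \<and> N \<subseteq> {1..3 * length T} \<and> card (independent_set T N) > 0 \<and>
        a \<in> independent_set T N \<and> a' \<notin> atoms T \<and> T' = replace_atom a a' T)"

definition SE_preserving ::
  "('a rule set \<Rightarrow> 'a rule set \<Rightarrow> bool) \<Rightarrow> ('a rule list \<Rightarrow> 'a rule list \<Rightarrow> bool) \<Rightarrow> bool" where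
  "SE_preserving eqv tr \<longleftrightarrow>
     (\<forall>P Q T'. tr (P @ Q) T' \<longrightarrow> eqv (set P) (set Q) \<longrightarrow>
        eqv (set (take (length P) T')) (set (drop (length P) T')))"

definition NSE_preserving ::
  "('a rule set \<Rightarrow> 'a rule set \<Rightarrow> bool) \<Rightarrow> ('a rule list \<Rightarrow> 'a rule list \<Rightarrow> bool) \<Rightarrow> bool" where
  "NSE_preserving eqv tr \<longleftrightarrow>
     (\<forall>P Q T'. tr (P @ Q) T' \<longrightarrow> \<not> eqv (set P) (set Q) \<longrightarrow>
        \<not> eqv (set (take (length P) T')) (set (drop (length P) T')))"

end

theory Submission
  imports Defs "HOL-Combinatorics.Transposition"
begin

text \<open>
  All notions involved commute with a bijective renaming of atoms, so semi-strong equivalence is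
  invariant under it. Renaming \<open>a\<close> to a fresh \<open>a'\<close> is not injective on all atoms, but on the rules
  of the tuple it agrees with the transposition of \<open>a\<close> and \<open>a'\<close>.
\<close>

text \<open>Under an injective map, images commute with intersections and an inclusion of images
  reflects back to the original sets. This transfers the disjointness tests for head and negative
  body, and the inclusion test for the positive body.\<close>

lemma satisfies_rule_map_rule:
  assumes "inj f"
  shows "satisfies_rule (f ` X) (map_rule f r) \<longleftrightarrow> satisfies_rule X r"
  using assms
  by (simp add: satisfies_rule_def rule.map_sel inj_image_subset_iff image_Int[symmetric])

lemma satisfies_map_rule:
  assumes "inj f"
  shows "satisfies (f ` X) (map_rule f ` P) \<longleftrightarrow> satisfies X P"
  by (simp add: satisfies_def satisfies_rule_map_rule[OF assms])

lemma GL_reduct_map_rule: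
  assumes "inj f"
  shows "GL_reduct (map_rule f ` P) (f ` X) = map_rule f ` GL_reduct P X"
proof -
  \<comment> \<open>As the image of a filtered program, the reduct splits into two parts that can be
    compared with the renaming separately: the choice of rules and the erasure of negative
    bodies.\<close>
  have GL_reduct_image:
    "GL_reduct P X =
       (\<lambda>r. Rule (head r) (pos_body r) {||}) ` {r \<in> P. fset (neg_body r) \<inter> X = {}}"
    for P :: "'c rule set" and X
    by (auto simp: GL_reduct_def)
  have "fset (neg_body (map_rule f r)) \<inter> f ` X = {} \<longleftrightarrow> fset (neg_body r) \<inter> X = {}" for r
    using assms by (simp add: rule.map_sel image_Int[symmetric])
  then have "{r \<in> map_rule f ` P. fset (neg_body r) \<inter> f ` X = {}} =
      map_rule f ` {r \<in> P. fset (neg_body r) \<inter> X = {}}"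
    by auto
  then show ?thesis
    by (simp add: GL_reduct_image image_image rule.map_sel)
qed

lemma ASP_stable_model_map_rule:
  assumes "inj f"
  shows "ASP_stable_model (map_rule f ` P) (f ` X) \<longleftrightarrow> ASP_stable_model P X"
proof -
  have "(\<exists>Y. Y \<subset> f ` X \<and> satisfies Y (map_rule f ` GL_reduct P X)) \<longleftrightarrow>
      (\<exists>Y. Y \<subset> X \<and> satisfies Y (GL_reduct P X))"
    (is "?L \<longleftrightarrow> ?R")
  proof
    assume ?L
    then obtain Y where Y: "Y \<subset> f ` X" "satisfies Y (map_rule f ` GL_reduct P X)"
      by blast
    then obtain Z where Z: "Y = f ` Z" "Z \<subseteq> X"
      by (meson psubset_imp_subset subset_imageE)
    with Y show ?R
      using satisfies_map_rule[OF assms] by blast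
  next
    assume ?R
    then obtain Y where Y: "Y \<subset> X" "satisfies Y (GL_reduct P X)"
      by blast
    \<comment> \<open>Injectivity keeps the inclusion strict.\<close>
    then have "f ` Y \<subset> f ` X"
      using assms by (simp add: image_strict_mono inj_on_subset)
    with Y show ?L
      using satisfies_map_rule[OF assms] by blast
  qed
  then show ?thesis
    by (simp add: ASP_stable_model_def GL_reduct_map_rule[OF assms] satisfies_map_rule[OF assms])
qed

lemma LPMLN_stable_model_map_rule:
  assumes "inj f"
  shows "LPMLN_stable_model (map_rule f ` P) (f ` X) \<longleftrightarrow> LPMLN_stable_model P X"
proof -
  have "{r \<in> map_rule f ` P. satisfies_rule (f ` X) r} =
      map_rule f ` {r \<in> P. satisfies_rule X r}"
    using satisfies_rule_map_rule[OF assms] by auto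
  then show ?thesis
    by (simp add: LPMLN_stable_model_def ASP_stable_model_map_rule[OF assms])
qed

text \<open>Contexts and interpretations range over everything on both sides, so they have to be
  carried in both directions. Surjectivity makes each one on the renamed side an image under
  \<open>f\<close>.\<close>

lemma semi_strongly_equivalent_map_rule:
  assumes "bij f"
  shows "semi_strongly_equivalent (map_rule f ` P) (map_rule f ` Q) \<longleftrightarrow>
    semi_strongly_equivalent P Q"
proof -
  have image_iff: "LPMLN_stable_model (map_rule f ` S \<union> map_rule f ` R) (f ` X) \<longleftrightarrow>
      LPMLN_stable_model (S \<union> R) X" for S R X
    using LPMLN_stable_model_map_rule[OF bij_is_inj[OF assms], of "S \<union> R" X]
    by (simp add: image_Un)
  have f_inv: "f \<circ> inv f = id"
    using assms by (simp add: bij_is_surj surj_iff[symmetric])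
  then have X_eq: "f ` inv f ` X = X" for X
    by (simp add: image_comp)
  have R_eq: "map_rule f ` map_rule (inv f) ` R = R" for R
    using f_inv by (simp add: image_image rule.map_comp rule.map_id)
  show ?thesis
    (is "?L \<longleftrightarrow> ?R")
  proof
    assume L: ?L
    show ?R
      unfolding semi_strongly_equivalent_def set_eq_iff mem_Collect_eq
    proof (intro allI impI)
      fix R X
      assume "finite (R :: 'a rule set)"
      then show "LPMLN_stable_model (P \<union> R) X \<longleftrightarrow> LPMLN_stable_model (Q \<union> R) X"
        using L image_iff[of _ R X]
        by (auto simp: semi_strongly_equivalent_def set_eq_iff)
    qed
  next
    assume R: ?R
    show ?L
      unfolding semi_strongly_equivalent_def set_eq_iff mem_Collect_eq
    proof (intro allI impI)
      fix R X
      assume "finite (R :: 'b rule set)"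
      \<comment> \<open>Here context and interpretation are pulled back along \<open>inv f\<close>;
        \<open>R_eq\<close> and \<open>X_eq\<close> recover the given ones.\<close>
      then show "LPMLN_stable_model (map_rule f ` P \<union> R) X \<longleftrightarrow>
          LPMLN_stable_model (map_rule f ` Q \<union> R) X"
        using R image_iff[of _ "map_rule (inv f) ` R" "inv f ` X"]
        by (auto simp: semi_strongly_equivalent_def set_eq_iff X_eq R_eq)
    qed
  qed
qed

lemma replace_atom_eq_transpose:
  assumes "a' \<notin> atoms T"
  shows "replace_atom a a' T = map (map_rule (transpose a a')) T"
  unfolding replace_atom_def
proof (rule map_cong[OF refl], rule rule.map_cong0)
  fix r x
  assume r: "r \<in> set T" and x: "x \<in> set_rule r"
  have "set_rule r = fset (head r) \<union> fset (pos_body r) \<union> fset (neg_body r)"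
    by (cases r) simp
  \<comment> \<open>The two renamings can differ only at \<open>a'\<close>, which no rule of
    \<open>T\<close> mentions.\<close>
  with r x assms have "x \<noteq> a'"
    by (auto simp: atoms_def)
  then show "(if x = a then a' else x) = transpose a a' x"
    by (simp add: transpose_def)
qed

text \<open>Renaming acts rule by rule, so cutting the result at \<open>length P\<close> gives the
  renamed \<open>P\<close> and the renamed \<open>Q\<close>. The two directions of the equivalence
  yield the two preservation properties.\<close>

lemma S_RP_semi_strongly_equivalent_iff:
  assumes "S_RP (P @ Q) T'"
  shows "semi_strongly_equivalent (set (take (length P) T')) (set (drop (length P) T')) \<longleftrightarrow>
    semi_strongly_equivalent (set P) (set Q)"
proof -
  obtain a a' where "a' \<notin> atoms (P @ Q)" "T' = replace_atom a a' (P @ Q)"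
    using assms by (auto simp: S_RP_def)
  then have "T' = map (map_rule (transpose a a')) (P @ Q)"
    by (simp add: replace_atom_eq_transpose)
  then show ?thesis
    by (simp add: semi_strongly_equivalent_map_rule)
qed

theorem theorem2:
  "SE_preserving (semi_strongly_equivalent :: 'a rule set \<Rightarrow> 'a rule set \<Rightarrow> bool) S_RP \<and>
   NSE_preserving (semi_strongly_equivalent :: 'a rule set \<Rightarrow> 'a rule set \<Rightarrow> bool) S_RP"
  by (simp add: SE_preserving_def NSE_preserving_def S_RP_semi_strongly_equivalent_iff)

end
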